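(* Let $1\le N\le L-1$. Let $(Y(n))_{n\ge0}$ be the simple random walk on $(\mathbb Z/L\mathbb Z)^N$ (nearest-neighbour Cayley graph structure), started from a point $y\in(\mathbb Z/L\mathbb Z)^N$ with pairwise distinct coordinates. Let $\sigma\in\mathfrak S_N$ be such that $\sigma\cdot y\in\mathcal W_{L,N}$ (see context) and set $$T=\inf\{n\ge0:\exists\,1\le i\ne j\le N,\ Y_i(n)=Y_j(n)\}.$$ Then, conditionally on $\{T>m\}$, the law of the permuted walk $\sigma\cdot Y=(\sigma\cdot Y(n))_{n\ge0}$ (which starts from $\sigma\cdot y$) converges as $m\to\infty$ to the law of the MESSEP $\Theta=(\Theta(n))_{n\ge0}$ on $\mathcal W_{L,N}$ started from $\sigma\cdot y$; that is, for every $n\ge0$ and all $e(0),\dots,e(n)\in(\mathbb Z/L\mathbb Z)^N$, $$\lim_{m\to\infty}\mathbb P\big(\sigma\cdot Y(0)=e(0),\dots,\sigma\cdot Y(n)=e(n)\,\big|\,T>m\big)=\mathbb P_{\sigma\cdot y}\big(\Theta(0)=e(0),\dots,\Theta(n)=e(n)\big).$$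
   Context: $\sigma\cdot y=(y_{\sigma(1)},\dots,y_{\sigma(N)})$ denotes the action of permutations on the coordinates. Let $\mathcal C_{L,N}$ be the set of $N$-element subsets of $\mathbb Z/L\mathbb Z$, made into an undirected graph by joining two subsets when one is obtained from the other by moving exactly one element by $\pm1$ to an unoccupied site. Let $\rho$ be the spectral radius of its adjacency matrix and $\psi>0$ a corresponding positive eigenvector. $\mathcal W_{L,N}$ is the set of $\theta\in(\mathbb Z/L\mathbb Z)^N$ for which there is $x\in\mathbb Z^N$ with $x_1<\cdots<x_N<x_1+L$ and $\theta_k=x_k\bmod L$ for all $k$. Two elements $\theta,\phi$ of $\mathcal W_{L,N}$ are adjacent, $\theta\sim\phi$, if they differ by $\pm1$ in exactly one coordinate. The MESSEP on $\mathcal W_{L,N}$ is the Markov chain $(\Theta(n))_{n\ge0}$ with $\mathbb P(\Theta(n+1)=\theta\mid\Theta(n)=\phi)=\psi_2(\theta)/(\rho\,\psi_2(\phi))$ if $\theta\sim\phi$ and $0$ otherwise, where $\psi_2(\theta)=\psi(\{\theta_1,\dots,\theta_N\})$. *)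

theory Defs
  imports
    "HOL-Probability.Probability"
    "HOL-Number_Theory.Residues"
    "Jordan_Normal_Form.Spectral_Radius"
begin

definition sites :: "nat \<Rightarrow> int set" where
  "sites L = carrier (residue_ring (int L))"

definition nn :: "nat \<Rightarrow> int \<Rightarrow> int \<Rightarrow> bool" where
  "nn L a b \<longleftrightarrow> [b = a + 1] (mod int L) \<or> [b = a - 1] (mod int L)"

text \<open>Points of $(\mathbb Z/L\mathbb Z)^N$ are functions on the index set \<open>{1..N}\<close>, extensional
  outside it, so that equality of functions is equality of coordinates.  For a permutation
  \<open>\<sigma>\<close> of \<open>{1..N}\<close>, the point $\sigma\cdot y=(y_{\sigma(1)},\dots,y_{\sigma(N)})$ is then simply
  \<open>y \<circ> \<sigma>\<close>.\<close>

definition torus :: "nat \<Rightarrow> nat \<Rightarrow> (nat \<Rightarrow> int) set" where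
  "torus L N = {1..N} \<rightarrow>\<^sub>E sites L"

definition torus_adj :: "nat \<Rightarrow> nat \<Rightarrow> (nat \<Rightarrow> int) \<Rightarrow> (nat \<Rightarrow> int) \<Rightarrow> bool" where
  "torus_adj L N u v \<longleftrightarrow>
     (\<exists>i\<in>{1..N}. nn L (u i) (v i) \<and> (\<forall>j\<in>{1..N} - {i}. u j = v j))"

text \<open>Uniform over the distinct neighbours.  For \<open>L = 2\<close> the two steps in a coordinate coincide,
  and a uniform choice among the \<open>2 * N\<close> signed unit steps gives the same kernel.\<close>

definition srw_kernel :: "nat \<Rightarrow> nat \<Rightarrow> (nat \<Rightarrow> int) \<Rightarrow> (nat \<Rightarrow> int) \<Rightarrow> real" where
  "srw_kernel L N u v =
     (if torus_adj L N u v then 1 / real (card {w \<in> torus L N. torus_adj L N u w}) else 0)"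

definition configs :: "nat \<Rightarrow> nat \<Rightarrow> int set set" where
  "configs L N = {A. A \<subseteq> sites L \<and> card A = N}"

definition config_adj :: "nat \<Rightarrow> int set \<Rightarrow> int set \<Rightarrow> bool" where
  "config_adj L A B \<longleftrightarrow>
     (\<exists>a\<in>A. \<exists>b\<in>sites L - A. nn L a b \<and> B = insert b (A - {a}))"

text \<open>Matrices are indexed by natural numbers, so the finite vertex set is enumerated by
  \<^const>\<open>from_nat_into\<close>, which is a bijection from \<open>{..<card (configs L N)}\<close> onto
  \<open>configs L N\<close>; the choice of enumeration affects neither the spectral radius nor
  which functions on \<open>configs L N\<close> represent eigenvectors.\<close>

definition adj_matrix :: "nat \<Rightarrow> nat \<Rightarrow> real Matrix.mat" where
  "adj_matrix L N =
     Matrix.mat (card (configs L N)) (card (configs L N))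
       (\<lambda>(i, j). if config_adj L (from_nat_into (configs L N) i) (from_nat_into (configs L N) j)
                 then 1 else 0)"

definition config_vec :: "nat \<Rightarrow> nat \<Rightarrow> (int set \<Rightarrow> real) \<Rightarrow> real Matrix.vec" where
  "config_vec L N f =
     Matrix.vec (card (configs L N)) (\<lambda>i. f (from_nat_into (configs L N) i))"

definition config_radius :: "nat \<Rightarrow> nat \<Rightarrow> real" where
  "config_radius L N = spectral_radius (map_mat complex_of_real (adj_matrix L N))"

definition positive_eigenvector :: "nat \<Rightarrow> nat \<Rightarrow> (int set \<Rightarrow> real) \<Rightarrow> bool" where
  "positive_eigenvector L N \<psi> \<longleftrightarrow>
     eigenvector (adj_matrix L N) (config_vec L N \<psi>) (config_radius L N) \<and>
     (\<forall>A\<in>configs L N. 0 < \<psi> A)"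

definition W :: "nat \<Rightarrow> nat \<Rightarrow> (nat \<Rightarrow> int) set" where
  "W L N = {\<theta> \<in> torus L N. \<exists>x :: nat \<Rightarrow> int.
     strict_mono_on {1..N} x \<and> x N < x 1 + int L \<and> (\<forall>k\<in>{1..N}. \<theta> k = x k mod int L)}"

definition messep_kernel ::
    "nat \<Rightarrow> nat \<Rightarrow> (int set \<Rightarrow> real) \<Rightarrow> (nat \<Rightarrow> int) \<Rightarrow> (nat \<Rightarrow> int) \<Rightarrow> real" where
  "messep_kernel L N \<psi> \<phi> \<theta> =
     (if torus_adj L N \<phi> \<theta> then \<psi> (\<theta> ` {1..N}) / (config_radius L N * \<psi> (\<phi> ` {1..N})) else 0)"

text \<open>\<open>markov_chain_from M S p x X\<close>: on the probability space \<open>M\<close>, the process \<open>X\<close> is a Markov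
  chain with values in \<open>S\<close>, started from \<open>x\<close>, where \<open>p s t\<close> is the probability of a
  transition from \<open>s\<close> to \<open>t\<close>.\<close>

definition markov_chain_from ::
    "'a measure \<Rightarrow> 's set \<Rightarrow> ('s \<Rightarrow> 's \<Rightarrow> real) \<Rightarrow> 's \<Rightarrow> (nat \<Rightarrow> 'a \<Rightarrow> 's) \<Rightarrow> bool" where
  "markov_chain_from M S p x X \<longleftrightarrow>
     prob_space M \<and>
     (\<forall>n. X n \<in> measurable M (count_space S)) \<and>
     (AE \<omega> in M. X 0 \<omega> = x) \<and>
     (\<forall>n s. (\<forall>k\<le>Suc n. s k \<in> S) \<longrightarrow> 0 < \<P>(\<omega> in M. \<forall>k\<le>n. X k \<omega> = s k) \<longrightarrow>
        \<P>(\<omega> in M. X (Suc n) \<omega> = s (Suc n) \<bar> \<forall>k\<le>n. X k \<omega> = s k) = p (s n) (s (Suc n)))"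

definition collision_time :: "nat \<Rightarrow> (nat \<Rightarrow> 'a \<Rightarrow> nat \<Rightarrow> int) \<Rightarrow> 'a \<Rightarrow> enat" where
  "collision_time N Y \<omega> =
     Inf (enat ` {n. \<exists>i\<in>{1..N}. \<exists>j\<in>{1..N}. i \<noteq> j \<and> Y n \<omega> i = Y n \<omega> j})"

end

theory Submission
  imports Defs
begin

text \<open>
  Up to time \<open>T\<close> the walk is the simple random walk killed on leaving the set \<open>D\<close> of points with
  pairwise distinct coordinates.  By the Markov property the conditional probability of a path
  \<open>s 0, \<dots>, s n\<close> in \<open>D\<close> is the product of its transition probabilities times the ratio
  \<open>Q (m - n) (s n) / Q m (s 0)\<close>, where \<open>Q j u\<close> is the probability that the walk started from
  \<open>u\<close> stays in \<open>D\<close> for \<open>j\<close> steps (\<open>survival\<close>).  The theorem is therefore a ratio limit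
  for \<open>Q\<close>.

  Sending a point to its set of coordinates maps the neighbours in \<open>D\<close> of each point bijectively onto
  the neighbours of its image in the configuration graph (\<open>bij_betw_neighbours\<close>), and the torus is
  regular, of degree \<open>d\<close> say.  Hence \<open>h u = \<psi> (u ` {1..N})\<close> is a positive eigenfunction of the
  killed kernel \<open>p\<close>, with eigenvalue \<open>\<mu> = \<rho> / d\<close>, and the Doob transform
  \<open>p u v * h v / (\<mu> * h u)\<close> is the MESSEP kernel.  Thus it suffices that
  \<open>Q j v / Q (j + 1) u\<close> tends to \<open>h v / (\<mu> * h u)\<close> whenever \<open>p u v > 0\<close>
  (\<open>survival_ratio_tendsto\<close>).

  One cannot expect \<open>Q j u / \<mu> ^ j\<close> to converge: for even \<open>L\<close> the configuration graph is
  bipartite, and this quantity may oscillate with the parity of \<open>j\<close>.  The ratio is insensitive to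
  this, because a step of the path and a shift of the remaining time change parity together, and
  there is a proof that does not look at the rest of the spectrum.  Put
  \<open>g j u = Q j u / (\<mu> ^ j * h u)\<close> (\<open>rescaled\<close>).  The Doob transform is a Markov kernel, reversible for the
  weights \<open>h\<^sup>2\<close> since \<open>p\<close> is symmetric, and it maps \<open>g j\<close> to \<open>g (j + 1)\<close>.  Therefore \<open>g\<close> stays
  above a positive constant, and the sum over edges, with their reversible weights, of the squares of
  \<open>g j v - g (j + 1) u\<close> equals the drop from \<open>j\<close> to \<open>j + 1\<close> of the squared \<open>L\<^sup>2\<close> norm of \<open>g j\<close>
  (\<open>energy_dissipation\<close>).  A nonincreasing nonnegative sequence has drops tending to zero, so these
  differences tend to zero along every edge, which is the ratio limit.

  Finally, a move that avoids collisions cannot change the cyclic order of the coordinates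
  (\<open>W_closed_under_moves\<close>).  So after relabelling by \<open>\<sigma>\<close> every collision-free path
  from the starting point stays in \<open>W L N\<close>, where its MESSEP probability is the product of Doob
  transforms found above; every other path has probability zero under both limit and MESSEP.
\<close>

section \<open>Survival probabilities of a symmetric killed kernel\<close>

text \<open>Conditioning on the first step leads to this recursion for the probability that a chain with
  kernel \<open>p\<close>, started from \<open>u \<in> D\<close>, stays in \<open>D\<close> for \<open>j\<close> steps
  (\<open>markov_chain_survival\<close>).\<close>

primrec survival :: "'s set \<Rightarrow> ('s \<Rightarrow> 's \<Rightarrow> real) \<Rightarrow> nat \<Rightarrow> 's \<Rightarrow> real" where
  "survival D p 0 u = 1"
| "survival D p (Suc j) u = (\<Sum>v\<in>D. p u v * survival D p j v)"

text \<open>The restriction of \<open>p\<close> to \<open>D\<close> may lose mass, and \<open>h\<close> is its Perron eigenfunction.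
  Symmetry of \<open>p\<close> is what makes the Doob transform by \<open>h\<close> reversible.\<close>

locale symmetric_killed_kernel =
  fixes D :: "'s set" and p :: "'s \<Rightarrow> 's \<Rightarrow> real" and h :: "'s \<Rightarrow> real" and \<mu> :: real
  assumes finite_D: "finite D"
    and p_nonneg: "\<And>u v. u \<in> D \<Longrightarrow> v \<in> D \<Longrightarrow> 0 \<le> p u v"
    and p_sym: "\<And>u v. u \<in> D \<Longrightarrow> v \<in> D \<Longrightarrow> p u v = p v u"
    and h_pos: "\<And>u. u \<in> D \<Longrightarrow> 0 < h u"
    and eigen: "\<And>u. u \<in> D \<Longrightarrow> (\<Sum>v\<in>D. p u v * h v) = \<mu> * h u"
    and \<mu>_pos: "0 < \<mu>"
begin

text \<open>Dividing by the eigenfunction turns the killed semigroup into the semigroup of the Doob transform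
  of \<open>p\<close> by \<open>h\<close>, applied to \<open>1 / h\<close>.\<close>

definition rescaled :: "nat \<Rightarrow> 's \<Rightarrow> real" where
  "rescaled j u = survival D p j u / (\<mu> ^ j * h u)"

text \<open>The minimum principle for the Doob transform: averaging keeps the lower bound that \<open>1 / h\<close>
  satisfies at time zero.\<close>

lemma survival_lower_bound: "\<exists>c>0. \<forall>j. \<forall>u\<in>D. c * (\<mu> ^ j * h u) \<le> survival D p j u"
proof -
  \<comment> \<open>Any positive \<open>c\<close> with \<open>c * h u \<le> 1\<close> on \<open>D\<close> would do; the summand \<open>1\<close> keeps it positive
    when \<open>D\<close> is empty.\<close>
  define c where "c = 1 / (1 + sum h D)"
  have s0: "0 \<le> sum h D"
    using h_pos by (intro sum_nonneg) (auto intro: less_imp_le)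
  then have c: "0 < c" by (simp add: c_def)
  have "c * (\<mu> ^ j * h u) \<le> survival D p j u" if "u \<in> D" for j u
    using that
  proof (induction j arbitrary: u)
    case 0
    have "h u \<le> sum h D"
      using 0 finite_D h_pos by (intro member_le_sum) (auto intro: less_imp_le)
    then show ?case using s0 by (simp add: c_def field_simps)
  next
    case (Suc j)
    have "c * (\<mu> ^ Suc j * h u) = c * \<mu> ^ j * (\<Sum>v\<in>D. p u v * h v)"
      using eigen[OF Suc.prems] by simp
    also have "\<dots> = (\<Sum>v\<in>D. p u v * (c * (\<mu> ^ j * h v)))"
      by (simp add: sum_distrib_left algebra_simps)
    also have "\<dots> \<le> (\<Sum>v\<in>D. p u v * survival D p j v)"
      using Suc p_nonneg by (intro sum_mono mult_left_mono) auto
    finally show ?case by simp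
  qed
  with c show ?thesis by blast
qed

lemma survival_pos: "u \<in> D \<Longrightarrow> 0 < survival D p j u"
proof -
  assume u: "u \<in> D"
  obtain c where "0 < c" "c * (\<mu> ^ j * h u) \<le> survival D p j u"
    using survival_lower_bound u by blast
  moreover have "0 < c * (\<mu> ^ j * h u)"
    using \<open>0 < c\<close> \<mu>_pos h_pos[OF u] by simp
  ultimately show ?thesis by linarith
qed

lemma rescaled_harmonic:
  assumes "u \<in> D"
  shows "(\<Sum>v\<in>D. p u v * h v * rescaled j v) = \<mu> * h u * rescaled (Suc j) u"
proof -
  have "(\<Sum>v\<in>D. p u v * h v * rescaled j v) = (\<Sum>v\<in>D. p u v * survival D p j v / \<mu> ^ j)"
    by (intro sum.cong refl) (use h_pos in \<open>force simp: rescaled_def field_simps\<close>)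
  also have "\<dots> = survival D p (Suc j) u / \<mu> ^ j"
    by (simp add: sum_divide_distrib)
  also have "\<dots> = \<mu> * h u * rescaled (Suc j) u"
    using \<mu>_pos h_pos[OF assms] by (simp add: rescaled_def field_simps)
  finally show ?thesis .
qed

text \<open>For a Markov operator \<open>P\<close> reversible with respect to \<open>\<pi>\<close>, the sum over edges of
  \<open>\<pi> u * P u v * (f v - P f u)\<^sup>2\<close> is \<open>\<parallel>f\<parallel>\<^sup>2 - \<parallel>P f\<parallel>\<^sup>2\<close>: the square of the first term
  sums to \<open>\<parallel>f\<parallel>\<^sup>2\<close> by stationarity of \<open>\<pi>\<close>, the cross term and the square of the second to
  multiples of \<open>\<parallel>P f\<parallel>\<^sup>2\<close>.  Here \<open>\<pi> = h\<^sup>2\<close> and \<open>P\<close> is the Doob transform, so that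
  \<open>\<pi> u * P u v = h u * h v * p u v / \<mu>\<close>, and \<open>f\<close> is the rescaled survival probability.\<close>

lemma energy_dissipation:
  "(\<Sum>u\<in>D. \<Sum>v\<in>D. h u * h v * p u v * (rescaled j v - rescaled (Suc j) u)\<^sup>2) =
     \<mu> * ((\<Sum>u\<in>D. (h u * rescaled j u)\<^sup>2) - (\<Sum>u\<in>D. (h u * rescaled (Suc j) u)\<^sup>2))"
proof -
  have A: "(\<Sum>u\<in>D. \<Sum>v\<in>D. h u * h v * p u v * (rescaled j v)\<^sup>2) = \<mu> * (\<Sum>v\<in>D. (h v * rescaled j v)\<^sup>2)"
  proof -
    have "(\<Sum>u\<in>D. \<Sum>v\<in>D. h u * h v * p u v * (rescaled j v)\<^sup>2) =
        (\<Sum>v\<in>D. \<Sum>u\<in>D. h u * h v * p u v * (rescaled j v)\<^sup>2)"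
      by (rule sum.swap)
    also have "\<dots> = (\<Sum>v\<in>D. h v * (rescaled j v)\<^sup>2 * (\<Sum>u\<in>D. p v u * h u))"
      unfolding sum_distrib_left by (intro sum.cong refl) (simp add: p_sym mult_ac)
    also have "\<dots> = \<mu> * (\<Sum>v\<in>D. (h v * rescaled j v)\<^sup>2)"
      unfolding sum_distrib_left[of \<mu>]
      by (intro sum.cong refl) (simp only: eigen, simp only: power2_eq_square mult_ac)
    finally show ?thesis .
  qed
  have B: "(\<Sum>u\<in>D. \<Sum>v\<in>D. h u * h v * p u v * (rescaled j v * rescaled (Suc j) u)) =
      \<mu> * (\<Sum>u\<in>D. (h u * rescaled (Suc j) u)\<^sup>2)"
  proof -
    have "(\<Sum>u\<in>D. \<Sum>v\<in>D. h u * h v * p u v * (rescaled j v * rescaled (Suc j) u)) =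
        (\<Sum>u\<in>D. h u * rescaled (Suc j) u * (\<Sum>v\<in>D. p u v * h v * rescaled j v))"
      unfolding sum_distrib_left by (intro sum.cong refl) (simp only: mult_ac)
    also have "\<dots> = \<mu> * (\<Sum>u\<in>D. (h u * rescaled (Suc j) u)\<^sup>2)"
      unfolding sum_distrib_left[of \<mu>]
      by (intro sum.cong refl) (simp only: rescaled_harmonic, simp only: power2_eq_square mult_ac)
    finally show ?thesis .
  qed
  have C: "(\<Sum>u\<in>D. \<Sum>v\<in>D. h u * h v * p u v * (rescaled (Suc j) u)\<^sup>2) =
      \<mu> * (\<Sum>u\<in>D. (h u * rescaled (Suc j) u)\<^sup>2)"
  proof -
    have "(\<Sum>u\<in>D. \<Sum>v\<in>D. h u * h v * p u v * (rescaled (Suc j) u)\<^sup>2) =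
        (\<Sum>u\<in>D. h u * (rescaled (Suc j) u)\<^sup>2 * (\<Sum>v\<in>D. p u v * h v))"
      unfolding sum_distrib_left by (intro sum.cong refl) (simp only: mult_ac)
    also have "\<dots> = \<mu> * (\<Sum>u\<in>D. (h u * rescaled (Suc j) u)\<^sup>2)"
      unfolding sum_distrib_left[of \<mu>]
      by (intro sum.cong refl) (simp only: eigen, simp only: power2_eq_square mult_ac)
    finally show ?thesis .
  qed
  have sq: "k * (a - b)\<^sup>2 = k * a\<^sup>2 - 2 * (k * (a * b)) + k * b\<^sup>2" for k a b :: real
    by (simp add: power2_eq_square algebra_simps)
  show ?thesis
    unfolding sq sum.distrib sum_subtractf sum_distrib_left[symmetric] A B C
    by (simp only: right_diff_distrib)
qed

lemma rescaled_difference_tendsto_0: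
  assumes u: "u \<in> D" and v: "v \<in> D" and uv: "0 < p u v"
  shows "(\<lambda>j. rescaled j v - rescaled (Suc j) u) \<longlonglongrightarrow> 0"
proof -
  define a where "a j = (\<Sum>u\<in>D. (h u * rescaled j u)\<^sup>2)" for j
  define t where "t j u v = h u * h v * p u v * (rescaled j v - rescaled (Suc j) u)\<^sup>2" for j u v
  have t0: "0 \<le> t j u' v'" if "u' \<in> D" "v' \<in> D" for j u' v'
    using that p_nonneg h_pos unfolding t_def by (intro mult_nonneg_nonneg) (auto intro: less_imp_le)
  have E: "(\<Sum>u\<in>D. \<Sum>v\<in>D. t j u v) = \<mu> * (a j - a (Suc j))" for j
    unfolding t_def a_def by (rule energy_dissipation)
  have "0 \<le> \<mu> * (a j - a (Suc j))" for j
    unfolding E[symmetric] by (intro sum_nonneg t0)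
  then have "decseq a"
    using \<mu>_pos by (intro decseq_SucI) (auto simp: zero_le_mult_iff)
  moreover have "0 \<le> a j" for j
    unfolding a_def by (intro sum_nonneg) simp
  ultimately obtain l where l: "a \<longlonglongrightarrow> l"
    using decseq_convergent by metis
  have "(\<lambda>j. \<mu> * (a j - a (Suc j))) \<longlonglongrightarrow> \<mu> * (l - l)"
    by (intro tendsto_intros l LIMSEQ_Suc[OF l])
  then have lim: "(\<lambda>j. \<mu> * (a j - a (Suc j))) \<longlonglongrightarrow> 0" by simp
  have le: "t j u v \<le> \<mu> * (a j - a (Suc j))" for j
  proof -
    have "t j u v \<le> (\<Sum>v\<in>D. t j u v)"
      using u v finite_D t0 by (intro member_le_sum) auto
    also have "\<dots> \<le> (\<Sum>u\<in>D. \<Sum>v\<in>D. t j u v)"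
      using u finite_D t0 by (intro member_le_sum[where f="\<lambda>u. \<Sum>v\<in>D. t j u v"] sum_nonneg) auto
    finally show ?thesis by (simp only: E)
  qed
  have "(\<lambda>j. t j u v) \<longlonglongrightarrow> 0"
    by (rule tendsto_sandwich[OF _ _ tendsto_const lim]) (simp_all add: le t0 u v)
  then have "(\<lambda>j. t j u v / (h u * h v * p u v)) \<longlonglongrightarrow> 0 / (h u * h v * p u v)"
    using h_pos[OF u] h_pos[OF v] uv by (intro tendsto_intros) auto
  moreover have "t j u v / (h u * h v * p u v) = (rescaled j v - rescaled (Suc j) u)\<^sup>2" for j
    using h_pos[OF u] h_pos[OF v] uv unfolding t_def by simp
  ultimately have "(\<lambda>j. (rescaled j v - rescaled (Suc j) u)\<^sup>2) \<longlonglongrightarrow> 0" by (simp only: div_0)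
  then have "(\<lambda>j. sqrt ((rescaled j v - rescaled (Suc j) u)\<^sup>2)) \<longlonglongrightarrow> sqrt 0"
    by (rule tendsto_real_sqrt)
  then show ?thesis by (simp only: real_sqrt_abs real_sqrt_zero tendsto_rabs_zero_iff)
qed

lemma survival_ratio_tendsto:
  assumes u: "u \<in> D" and v: "v \<in> D"
  shows "(\<lambda>j. p u v * survival D p j v / survival D p (Suc j) u) \<longlonglongrightarrow> p u v * h v / (\<mu> * h u)"
proof (cases "p u v = 0")
  case False
  then have uv: "0 < p u v" using p_nonneg[OF u v] by simp
  obtain c where c: "0 < c" and low: "\<And>j u. u \<in> D \<Longrightarrow> c * (\<mu> ^ j * h u) \<le> survival D p j u"
    using survival_lower_bound by blast
  have gc: "c \<le> rescaled (Suc j) u" for j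
    using low[OF u, of "Suc j"] \<mu>_pos h_pos[OF u]
    unfolding rescaled_def by (subst pos_le_divide_eq) auto
  have lim: "(\<lambda>j. \<bar>rescaled j v - rescaled (Suc j) u\<bar> / c) \<longlonglongrightarrow> 0"
    using rescaled_difference_tendsto_0[OF u v uv] by (intro tendsto_divide_zero tendsto_rabs_zero)
  have "(\<lambda>j. (rescaled j v - rescaled (Suc j) u) / rescaled (Suc j) u) \<longlonglongrightarrow> 0"
  proof (rule Lim_null_comparison[OF _ lim], intro always_eventually allI)
    fix j
    show "norm ((rescaled j v - rescaled (Suc j) u) / rescaled (Suc j) u) \<le> \<bar>rescaled j v - rescaled (Suc j) u\<bar> / c"
    proof -
      have gp: "0 < rescaled (Suc j) u" using gc[of j] c by linarith
      have "norm (a / b) = \<bar>a\<bar> / b" if "0 < b" for a b :: real using that by simp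
      then show ?thesis
        using divide_left_mono[OF gc[of j] abs_ge_zero mult_pos_pos[OF gp c]] gp by simp
    qed
  qed
  then have "(\<lambda>j. p u v * h v / (\<mu> * h u) * (1 + (rescaled j v - rescaled (Suc j) u) / rescaled (Suc j) u))
      \<longlonglongrightarrow> p u v * h v / (\<mu> * h u) * (1 + 0)"
    by (intro tendsto_intros)
  moreover have "p u v * h v / (\<mu> * h u) * (1 + (rescaled j v - rescaled (Suc j) u) / rescaled (Suc j) u) =
      p u v * survival D p j v / survival D p (Suc j) u" for j
  proof -
    have "1 + (rescaled j v - rescaled (Suc j) u) / rescaled (Suc j) u = rescaled j v / rescaled (Suc j) u"
      using gc[of j] c by (simp only: diff_divide_distrib) auto
    then show ?thesis
      using h_pos[OF u] h_pos[OF v] \<mu>_pos survival_pos[OF u, of "Suc j"]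
      by (simp add: rescaled_def field_simps)
  qed
  ultimately show ?thesis by (simp only: add_0_right mult_1_right)
qed simp

text \<open>The ratio of survival probabilities at the two ends of a path telescopes into ratios along its
  single steps, each of which lowers the remaining time by one.\<close>

lemma path_survival_tendsto:
  assumes "\<forall>k\<le>n. s k \<in> D"
  shows "(\<lambda>m. (\<Prod>k<n. p (s k) (s (Suc k))) * survival D p m (s n) / survival D p (m + n) (s 0))
    \<longlonglongrightarrow> (\<Prod>k<n. p (s k) (s (Suc k)) * h (s (Suc k)) / (\<mu> * h (s k)))"
  using assms
proof (induction n)
  case 0
  then have "survival D p m (s 0) \<noteq> 0" for m
    using survival_pos[of "s 0" m] by simp
  then show ?case by simp
next
  case (Suc n)
  let ?Q = "survival D p"
  let ?P = "\<lambda>n. \<Prod>k<n. p (s k) (s (Suc k))"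
  have IH: "(\<lambda>m. ?P n * ?Q m (s n) / ?Q (m + n) (s 0))
      \<longlonglongrightarrow> (\<Prod>k<n. p (s k) (s (Suc k)) * h (s (Suc k)) / (\<mu> * h (s k)))"
    using Suc by simp
  have "(\<lambda>m. (?P n * ?Q (Suc m) (s n) / ?Q (Suc m + n) (s 0)) *
        (p (s n) (s (Suc n)) * ?Q m (s (Suc n)) / ?Q (Suc m) (s n)))
      \<longlonglongrightarrow> (\<Prod>k<n. p (s k) (s (Suc k)) * h (s (Suc k)) / (\<mu> * h (s k))) *
        (p (s n) (s (Suc n)) * h (s (Suc n)) / (\<mu> * h (s n)))"
    using Suc.prems by (intro tendsto_mult LIMSEQ_Suc[OF IH] survival_ratio_tendsto) auto
  moreover have "(?P n * ?Q (Suc m) (s n) / ?Q (Suc m + n) (s 0)) *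
        (p (s n) (s (Suc n)) * ?Q m (s (Suc n)) / ?Q (Suc m) (s n)) =
      ?P (Suc n) * ?Q m (s (Suc n)) / ?Q (m + Suc n) (s 0)" for m
    using survival_pos[of "s n" "Suc m"] Suc.prems
    by (simp del: survival.simps add: field_simps)
  ultimately show ?case by (simp only: prod.lessThan_Suc)
qed

end

section \<open>Path probabilities of Markov chains\<close>

lemma markov_chain_event_measurable:
  assumes "markov_chain_from M S p x X"
  shows "{\<omega> \<in> space M. P (X k \<omega>)} \<in> sets M"
proof -
  have X: "X k \<in> measurable M (count_space S)"
    using assms by (simp add: markov_chain_from_def)
  have "{\<omega> \<in> space M. P (X k \<omega>)} = X k -` {s \<in> S. P s} \<inter> space M"
    using measurable_space[OF X] by auto
  also have "\<dots> \<in> sets M"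
    by (rule measurable_sets[OF X]) auto
  finally show ?thesis .
qed

lemma markov_chain_path_measurable:
  assumes "markov_chain_from M S p x X"
  shows "{\<omega> \<in> space M. (\<forall>k\<le>n. X k \<omega> = s k) \<and> (\<forall>k\<le>m. X k \<omega> \<in> D)} \<in> sets M"
  by (intro sets.sets_Collect markov_chain_event_measurable[OF assms])

text \<open>The transition law constrains only histories of positive probability; for the others both sides
  vanish, so that the product rule needs no such restriction.\<close>

lemma markov_chain_step:
  assumes mc: "markov_chain_from M S p x X" and s: "\<forall>k\<le>Suc n. s k \<in> S"
  shows "\<P>(\<omega> in M. \<forall>k\<le>Suc n. X k \<omega> = s k) =
    \<P>(\<omega> in M. \<forall>k\<le>n. X k \<omega> = s k) * p (s n) (s (Suc n))"
proof -
  interpret prob_space M using mc by (simp add: markov_chain_from_def)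
  have "(\<forall>k\<le>Suc n. X k \<omega> = s k) \<longleftrightarrow> X (Suc n) \<omega> = s (Suc n) \<and> (\<forall>k\<le>n. X k \<omega> = s k)" for \<omega>
    by (auto simp: le_Suc_eq)
  then have joint: "{\<omega> \<in> space M. \<forall>k\<le>Suc n. X k \<omega> = s k} =
      {\<omega> \<in> space M. X (Suc n) \<omega> = s (Suc n) \<and> (\<forall>k\<le>n. X k \<omega> = s k)}"
    by blast
  have meas: "{\<omega> \<in> space M. \<forall>k\<le>n. X k \<omega> = s k} \<in> sets M"
    using markov_chain_path_measurable[OF mc, of n s n UNIV] by (simp only: UNIV_I simp_thms)
  show ?thesis
  proof (cases "0 < \<P>(\<omega> in M. \<forall>k\<le>n. X k \<omega> = s k)")
    case True
    note transition = mc[unfolded markov_chain_from_def, THEN conjunct2, THEN conjunct2,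
        THEN conjunct2, THEN spec[of _ n], THEN spec[of _ s], THEN mp, OF s, THEN mp, OF True]
    from transition have "\<P>(\<omega> in M. X (Suc n) \<omega> = s (Suc n) \<and> (\<forall>k\<le>n. X k \<omega> = s k)) =
        p (s n) (s (Suc n)) * \<P>(\<omega> in M. \<forall>k\<le>n. X k \<omega> = s k)"
      by (simp only: cond_prob_def nonzero_divide_eq_eq[OF less_imp_neq[OF True, symmetric]])
    then show ?thesis unfolding joint by (simp only: mult.commute)
  next
    case False
    then have z: "\<P>(\<omega> in M. \<forall>k\<le>n. X k \<omega> = s k) = 0"
      using measure_nonneg[of M "{\<omega> \<in> space M. \<forall>k\<le>n. X k \<omega> = s k}"] by linarith
    have "\<P>(\<omega> in M. \<forall>k\<le>Suc n. X k \<omega> = s k) \<le> \<P>(\<omega> in M. \<forall>k\<le>n. X k \<omega> = s k)"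
      unfolding joint by (rule finite_measure_mono[OF _ meas]) blast
    with z show ?thesis
      using measure_nonneg[of M "{\<omega> \<in> space M. \<forall>k\<le>Suc n. X k \<omega> = s k}"] by (simp only: mult_zero_left)
  qed
qed

lemma markov_chain_path_probability:
  assumes mc: "markov_chain_from M S p x X" and s: "\<forall>k\<le>n. s k \<in> S"
  shows "\<P>(\<omega> in M. \<forall>k\<le>n. X k \<omega> = s k) =
    (if s 0 = x then \<Prod>k<n. p (s k) (s (Suc k)) else 0)"
  using s
proof (induction n)
  case 0
  interpret prob_space M using mc by (simp add: markov_chain_from_def)
  have ae: "AE \<omega> in M. X 0 \<omega> = x" using mc by (simp add: markov_chain_from_def)
  show ?case
  proof (cases "s 0 = x")
    case True
    then show ?thesis
      using ae markov_chain_event_measurable[OF mc, of "\<lambda>z. z = x" 0] by (simp add: prob_Collect_eq_1)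
  next
    case False
    with ae have "AE \<omega> in M. X 0 \<omega> \<noteq> s 0" by auto
    with False show ?thesis
      using markov_chain_event_measurable[OF mc, of "\<lambda>z. z = s 0" 0] by (simp add: prob_Collect_eq_0)
  qed
next
  case (Suc n)
  then have "\<P>(\<omega> in M. \<forall>k\<le>n. X k \<omega> = s k) =
      (if s 0 = x then \<Prod>k<n. p (s k) (s (Suc k)) else 0)"
    by simp
  then show ?case
    unfolding markov_chain_step[OF mc Suc.prems] by simp
qed

text \<open>The Markov property at time \<open>n\<close> for the event of staying in \<open>D\<close>, obtained by
  lengthening the prescribed path by one of the finitely many possible values of \<open>X (n + 1)\<close> in
  \<open>D\<close>.\<close>

lemma markov_chain_path_and_survival:
  assumes mc: "markov_chain_from M S p x X" and "D \<subseteq> S" and "finite D"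
    and "\<forall>k\<le>n. s k \<in> D"
  shows "\<P>(\<omega> in M. (\<forall>k\<le>n. X k \<omega> = s k) \<and> (\<forall>k\<le>n + j. X k \<omega> \<in> D)) =
    \<P>(\<omega> in M. \<forall>k\<le>n. X k \<omega> = s k) * survival D p j (s n)"
  using assms(4)
proof (induction j arbitrary: n s)
  case 0
  then have "{\<omega> \<in> space M. (\<forall>k\<le>n. X k \<omega> = s k) \<and> (\<forall>k\<le>n + 0. X k \<omega> \<in> D)} =
      {\<omega> \<in> space M. \<forall>k\<le>n. X k \<omega> = s k}"
    by auto
  then show ?case by simp
next
  case (Suc j)
  interpret prob_space M using mc by (simp add: markov_chain_from_def)
  define E where "E v = {\<omega> \<in> space M. (\<forall>k\<le>Suc n. X k \<omega> = (s(Suc n := v)) k) \<and>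
      (\<forall>k\<le>Suc n + j. X k \<omega> \<in> D)}" for v
  have path_Suc: "(\<forall>k\<le>Suc n. X k \<omega> = (s(Suc n := v)) k) \<longleftrightarrow>
      (\<forall>k\<le>n. X k \<omega> = s k) \<and> X (Suc n) \<omega> = v" for v \<omega>
    by (auto simp: le_Suc_eq)
  have "{\<omega> \<in> space M. (\<forall>k\<le>n. X k \<omega> = s k) \<and> (\<forall>k\<le>n + Suc j. X k \<omega> \<in> D)} = (\<Union>v\<in>D. E v)"
    unfolding E_def path_Suc by auto
  then have "\<P>(\<omega> in M. (\<forall>k\<le>n. X k \<omega> = s k) \<and> (\<forall>k\<le>n + Suc j. X k \<omega> \<in> D)) = prob (\<Union>v\<in>D. E v)"
    by simp
  also have "\<dots> = (\<Sum>v\<in>D. prob (E v))"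
  proof (rule finite_measure_finite_Union[OF \<open>finite D\<close>])
    show "E ` D \<subseteq> events"
      unfolding E_def using markov_chain_path_measurable[OF mc] by blast
    show "disjoint_family_on E D"
      by (auto simp: disjoint_family_on_def E_def)
  qed
  also have "\<dots> = (\<Sum>v\<in>D. \<P>(\<omega> in M. \<forall>k\<le>n. X k \<omega> = s k) * (p (s n) v * survival D p j v))"
  proof (rule sum.cong[OF refl])
    fix v assume v: "v \<in> D"
    let ?s = "s(Suc n := v)"
    have "prob (E v) = \<P>(\<omega> in M. \<forall>k\<le>Suc n. X k \<omega> = ?s k) * survival D p j (?s (Suc n))"
      unfolding E_def by (rule Suc.IH) (use v Suc.prems in auto)
    also have "\<P>(\<omega> in M. \<forall>k\<le>Suc n. X k \<omega> = ?s k) =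
        \<P>(\<omega> in M. \<forall>k\<le>n. X k \<omega> = ?s k) * p (?s n) (?s (Suc n))"
      by (rule markov_chain_step[OF mc]) (use v Suc.prems \<open>D \<subseteq> S\<close> in auto)
    also have "{\<omega> \<in> space M. \<forall>k\<le>n. X k \<omega> = ?s k} = {\<omega> \<in> space M. \<forall>k\<le>n. X k \<omega> = s k}"
      by auto
    finally show "prob (E v) = \<P>(\<omega> in M. \<forall>k\<le>n. X k \<omega> = s k) * (p (s n) v * survival D p j v)"
      by simp
  qed
  also have "\<dots> = \<P>(\<omega> in M. \<forall>k\<le>n. X k \<omega> = s k) * survival D p (Suc j) (s n)"
    by (simp add: sum_distrib_left)
  finally show ?case .
qed

lemma markov_chain_survival:
  assumes mc: "markov_chain_from M S p x X" and D: "D \<subseteq> S" "finite D" and x: "x \<in> D"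
  shows "\<P>(\<omega> in M. \<forall>k\<le>m. X k \<omega> \<in> D) = survival D p m x"
proof -
  interpret prob_space M using mc by (simp add: markov_chain_from_def)
  have ae: "AE \<omega> in M. X 0 \<omega> = x" using mc by (simp add: markov_chain_from_def)
  have "\<P>(\<omega> in M. \<forall>k\<le>m. X k \<omega> \<in> D) =
      \<P>(\<omega> in M. (\<forall>k\<le>0. X k \<omega> = x) \<and> (\<forall>k\<le>0 + m. X k \<omega> \<in> D))"
  proof (rule measure_eq_AE)
    show "AE \<omega> in M. \<omega> \<in> {\<omega> \<in> space M. \<forall>k\<le>m. X k \<omega> \<in> D} \<longleftrightarrow>
        \<omega> \<in> {\<omega> \<in> space M. (\<forall>k\<le>0. X k \<omega> = x) \<and> (\<forall>k\<le>0 + m. X k \<omega> \<in> D)}"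
      using ae by eventually_elim simp
    show "{\<omega> \<in> space M. \<forall>k\<le>m. X k \<omega> \<in> D} \<in> events"
      by (intro sets.sets_Collect markov_chain_event_measurable[OF mc])
  qed (rule markov_chain_path_measurable[OF mc])
  also have "\<dots> = \<P>(\<omega> in M. \<forall>k\<le>0. X k \<omega> = x) * survival D p m x"
    using markov_chain_path_and_survival[OF mc D, of 0 "\<lambda>_. x"] x by simp
  also have "\<P>(\<omega> in M. \<forall>k\<le>0. X k \<omega> = x) = 1"
    using markov_chain_path_probability[OF mc, of 0 "\<lambda>_. x"] x D by auto
  finally show ?thesis by simp
qed

text \<open>The Markov property writes the conditional probability as the product of the transition
  probabilities along the path times a ratio of survival probabilities; in the limit the ratio
  supplies the factors \<open>h (s (Suc k)) / (\<mu> * h (s k))\<close> that turn the kernel into its Doob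
  transform.\<close>

lemma (in symmetric_killed_kernel) conditioned_path_tendsto:
  assumes mc: "markov_chain_from M S p x X" and D: "D \<subseteq> S" and x: "x \<in> D"
    and s: "\<forall>k\<le>n. s k \<in> D"
  shows "(\<lambda>m. \<P>(\<omega> in M. (\<forall>k\<le>n. X k \<omega> = s k) \<bar> (\<forall>k\<le>m. X k \<omega> \<in> D)))
    \<longlonglongrightarrow> (if s 0 = x then \<Prod>k<n. p (s k) (s (Suc k)) * h (s (Suc k)) / (\<mu> * h (s k)) else 0)"
proof -
  have "\<P>(\<omega> in M. (\<forall>k\<le>n. X k \<omega> = s k) \<bar> (\<forall>k\<le>m + n. X k \<omega> \<in> D)) =
      (if s 0 = x then \<Prod>k<n. p (s k) (s (Suc k)) else 0) * survival D p m (s n) /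
        survival D p (m + n) x" for m
    using markov_chain_path_and_survival[OF mc D finite_D s, of m]
      markov_chain_path_probability[OF mc, of n s] s D
    unfolding cond_prob_def markov_chain_survival[OF mc D finite_D x]
    by (simp add: add.commute[of n m] subset_iff)
  then have "(\<lambda>m. \<P>(\<omega> in M. (\<forall>k\<le>n. X k \<omega> = s k) \<bar> (\<forall>k\<le>m + n. X k \<omega> \<in> D)))
    \<longlonglongrightarrow> (if s 0 = x then \<Prod>k<n. p (s k) (s (Suc k)) * h (s (Suc k)) / (\<mu> * h (s k)) else 0)"
    using path_survival_tendsto[OF s] by auto
  then show ?thesis by (rule LIMSEQ_offset)
qed

section \<open>Collision-free points of the discrete torus\<close>

definition distinct_torus :: "nat \<Rightarrow> nat \<Rightarrow> (nat \<Rightarrow> int) set" where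
  "distinct_torus L N = {u \<in> torus L N. inj_on u {1..N}}"

lemma sites_eq: "sites L = {0..<int L}"
  by (auto simp: sites_def residue_ring_def)

lemma finite_torus: "finite (torus L N)"
  by (simp add: torus_def sites_eq finite_PiE)

lemma finite_distinct_torus: "finite (distinct_torus L N)"
  by (simp add: distinct_torus_def finite_torus)

lemma nn_sym:
  assumes "nn L a b" shows "nn L b a"
proof -
  have "[a = b - c] (mod int L)" if "[b = a + c] (mod int L)" for c
  proof -
    have "int L dvd - (b - (a + c))"
      using that by (simp only: dvd_minus_iff cong_iff_dvd_diff)
    moreover have "- (b - (a + c)) = a - (b - c)" by simp
    ultimately show ?thesis by (simp only: cong_iff_dvd_diff)
  qed
  from this[of 1] this[of "- 1"] assms show ?thesis by (auto simp: nn_def)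
qed

lemma nn_shift:
  assumes "nn L a b" and "[b' - a' = b - a] (mod int L)"
  shows "nn L a' b'"
proof -
  have "[b' = a' + c] (mod int L)" if "[b = a + c] (mod int L)" for c
  proof -
    have "int L dvd (b - (a + c)) + (b' - a' - (b - a))"
      using that assms(2) by (intro dvd_add) (simp_all add: cong_iff_dvd_diff)
    moreover have "(b - (a + c)) + (b' - a' - (b - a)) = b' - (a' + c)" by simp
    ultimately show ?thesis by (simp only: cong_iff_dvd_diff)
  qed
  from this[of 1] this[of "- 1"] assms(1) show ?thesis by (auto simp: nn_def)
qed

lemma nn_irrefl:
  assumes "2 \<le> L" shows "\<not> nn L a a"
proof
  assume "nn L a a"
  then have "int L dvd 1"
    by (auto simp: nn_def cong_iff_dvd_diff)
  with assms show False by simp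
qed

lemma torus_adj_sym:
  assumes "torus_adj L N u v" shows "torus_adj L N v u"
proof -
  from assms obtain i where "i \<in> {1..N}" "nn L (u i) (v i)" "\<forall>j\<in>{1..N} - {i}. u j = v j"
    unfolding torus_adj_def by blast
  then show ?thesis
    unfolding torus_adj_def using nn_sym[of L "u i" "v i"] by (intro bexI[of _ i]) simp_all
qed

lemma torus_adj_iff_update:
  assumes u: "u \<in> torus L N" and v: "v \<in> torus L N"
  shows "torus_adj L N u v \<longleftrightarrow> (\<exists>i\<in>{1..N}. nn L (u i) (v i) \<and> v = u(i := v i))"
proof -
  have upd: "(\<forall>j\<in>{1..N} - {i}. u j = v j) \<longleftrightarrow> v = u(i := v i)" if "i \<in> {1..N}" for i
  proof
    assume eq: "\<forall>j\<in>{1..N} - {i}. u j = v j"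
    show "v = u(i := v i)"
    proof
      fix j
      have "u j = v j" if "j \<notin> {1..N}"
        using PiE_arb[OF u[unfolded torus_def] that] PiE_arb[OF v[unfolded torus_def] that] by simp
      with eq show "v j = (u(i := v i)) j" by (cases "j = i"; cases "j \<in> {1..N}") auto
    qed
  next
    assume eq: "v = u(i := v i)"
    show "\<forall>j\<in>{1..N} - {i}. u j = v j"
    proof
      fix j assume "j \<in> {1..N} - {i}"
      then show "u j = v j" using fun_cong[OF eq, of j] by simp
    qed
  qed
  then show ?thesis unfolding torus_adj_def by (intro bex_cong refl conj_cong upd)
qed

text \<open>Translations act transitively on the torus and preserve adjacency.  This makes the walk's kernel
  symmetric, and it covers the degenerate case \<open>L = 2\<close>, where the two steps in a coordinate
  coincide, together with all others.\<close>

lemma torus_degree_const: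
  assumes L: "2 \<le> L" and u: "u \<in> torus L N" and u': "u' \<in> torus L N"
  shows "card {w \<in> torus L N. torus_adj L N u w} = card {w \<in> torus L N. torus_adj L N u' w}"
proof -
  define \<tau> where "\<tau> c w = (\<lambda>i\<in>{1..N}. (w i + c i) mod int L)" for c w :: "nat \<Rightarrow> int"
  have maps: "\<tau> (\<lambda>i. u2 i - u1 i) w \<in> {w \<in> torus L N. torus_adj L N u2 w}"
    if w: "w \<in> torus L N" "torus_adj L N u1 w" and u2: "u2 \<in> torus L N" for u1 u2 w
  proof -
    let ?w = "\<tau> (\<lambda>i. u2 i - u1 i) w"
    from w obtain i where i: "i \<in> {1..N}" "nn L (u1 i) (w i)" "\<forall>j\<in>{1..N} - {i}. u1 j = w j"
      by (auto simp: torus_adj_def)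
    have wt: "?w \<in> torus L N"
      using L by (auto simp: \<tau>_def torus_def sites_eq)
    have wn: "nn L (u2 i) (?w i)"
    proof (rule nn_shift[OF i(2)])
      show "[?w i - u2 i = w i - u1 i] (mod int L)"
        using i(1) unfolding cong_def by (simp add: \<tau>_def mod_diff_left_eq)
    qed
    have we: "u2 j = ?w j" if "j \<in> {1..N} - {i}" for j
      using that i(3) u2 by (auto simp: \<tau>_def torus_def sites_eq PiE_iff)
    have "torus_adj L N u2 ?w"
      unfolding torus_adj_def by (intro bexI[of _ i] conjI ballI wn we i(1))
    with wt show ?thesis by simp
  qed
  have inv: "\<tau> (\<lambda>i. u1 i - u2 i) (\<tau> (\<lambda>i. u2 i - u1 i) w) = w" if "w \<in> torus L N" for u1 u2 w
  proof
    fix i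
    show "\<tau> (\<lambda>i. u1 i - u2 i) (\<tau> (\<lambda>i. u2 i - u1 i) w) i = w i"
      using that by (cases "i \<in> {1..N}") (auto simp: \<tau>_def torus_def sites_eq PiE_iff mod_simps extensional_def)
  qed
  have "bij_betw (\<tau> (\<lambda>i. u' i - u i)) {w \<in> torus L N. torus_adj L N u w}
      {w \<in> torus L N. torus_adj L N u' w}"
    by (rule bij_betw_byWitness[where f' = "\<tau> (\<lambda>i. u i - u' i)"])
      (use inv maps u u' in blast)+
  then show ?thesis by (rule bij_betw_same_card)
qed

lemma distinct_torus_move:
  assumes u: "u \<in> distinct_torus L N" and i: "i \<in> {1..N}" and b: "b \<in> sites L" "b \<notin> u ` {1..N}"
  shows "u(i := b) \<in> distinct_torus L N"
    and "(u(i := b)) ` {1..N} = insert b (u ` {1..N} - {u i})"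
proof -
  have inj: "inj_on u {1..N}" and ut: "u \<in> {1..N} \<rightarrow>\<^sub>E sites L"
    using u by (simp_all add: distinct_torus_def torus_def)
  have "u(i := b) \<in> {1..N} \<rightarrow>\<^sub>E sites L"
    using ut b(1) i by (auto simp: PiE_iff extensional_def)
  moreover have "inj_on (u(i := b)) {1..N}"
    using b(2) by (intro inj_on_fun_updI inj)
  ultimately show "u(i := b) \<in> distinct_torus L N"
    by (simp add: distinct_torus_def torus_def)
  have "(u(i := b)) ` {1..N} = insert b (u ` ({1..N} - {i}))"
    using i by (auto simp: fun_upd_image)
  also have "u ` ({1..N} - {i}) = u ` {1..N} - {u i}"
    using i inj by (simp add: inj_on_image_set_diff)
  finally show "(u(i := b)) ` {1..N} = insert b (u ` {1..N} - {u i})" .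
qed

lemma distinct_torus_adjE:
  assumes L: "2 \<le> L" and u: "u \<in> distinct_torus L N" and v: "v \<in> distinct_torus L N"
    and adj: "torus_adj L N u v"
  obtains i where "i \<in> {1..N}" "nn L (u i) (v i)" "v = u(i := v i)"
    "v i \<in> sites L" "v i \<notin> u ` {1..N}"
proof -
  have ut: "u \<in> torus L N" and vt: "v \<in> torus L N" and inj: "inj_on v {1..N}"
    using u v by (simp_all add: distinct_torus_def)
  obtain i where i: "i \<in> {1..N}" and nn: "nn L (u i) (v i)" and upd: "v = u(i := v i)"
    using adj torus_adj_iff_update[OF ut vt] by blast
  have "v i \<noteq> u j" if j: "j \<in> {1..N}" for j
  proof
    assume eq: "v i = u j"
    show False
    proof (cases "j = i")
      case True
      with eq nn nn_irrefl[OF L] show False by simp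
    next
      case False
      with fun_cong[OF upd, of j] have "v j = u j" by simp
      with eq have "v i = v j" by simp
      with inj i j False show False by (auto dest: inj_onD)
    qed
  qed
  then have "v i \<notin> u ` {1..N}" by blast
  moreover have "v i \<in> sites L" using vt i by (auto simp: torus_def)
  ultimately show thesis using that i nn upd by blast
qed

lemma image_in_configs: "u \<in> distinct_torus L N \<Longrightarrow> u ` {1..N} \<in> configs L N"
  by (auto simp: distinct_torus_def torus_def configs_def card_image)

text \<open>A collision-free point \<open>u\<close> is a labelling of the particles of its image.  A move to a
  configuration \<open>B\<close> empties one site and fills another, and both can be read off from \<open>B\<close>;
  since \<open>u\<close> is injective the emptied site names the coordinate that moves, so the labelling is
  carried along in exactly one way.\<close>

lemma bij_betw_neighbours:
  assumes L: "2 \<le> L" and u: "u \<in> distinct_torus L N"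
  shows "bij_betw (\<lambda>v. v ` {1..N}) {v \<in> distinct_torus L N. torus_adj L N u v}
    {B \<in> configs L N. config_adj L (u ` {1..N}) B}"
  unfolding bij_betw_def
proof (intro conjI subset_antisym)
  let ?A = "u ` {1..N}"
  have inj_u: "inj_on u {1..N}" using u by (simp add: distinct_torus_def)
  show "inj_on (\<lambda>v. v ` {1..N}) {v \<in> distinct_torus L N. torus_adj L N u v}"
  proof (rule inj_onI)
    fix v w
    assume v: "v \<in> {v \<in> distinct_torus L N. torus_adj L N u v}"
      and w: "w \<in> {v \<in> distinct_torus L N. torus_adj L N u v}"
      and eq: "v ` {1..N} = w ` {1..N}"
    from v obtain i where i: "i \<in> {1..N}" "v = u(i := v i)" "v i \<in> sites L" "v i \<notin> ?A"
      using distinct_torus_adjE[OF L u] by blast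
    from w obtain j where j: "j \<in> {1..N}" "w = u(j := w j)" "w j \<in> sites L" "w j \<notin> ?A"
      using distinct_torus_adjE[OF L u] by blast
    have V: "v ` {1..N} = insert (v i) (?A - {u i})"
      by (rule distinct_torus_move(2)[OF u i(1,3,4), folded i(2)])
    have W: "w ` {1..N} = insert (w j) (?A - {u j})"
      by (rule distinct_torus_move(2)[OF u j(1,3,4), folded j(2)])
    have VW: "insert (v i) (?A - {u i}) = insert (w j) (?A - {u j})"
      using eq unfolding V W .
    have "v i \<in> insert (w j) (?A - {u j})" unfolding VW[symmetric] by simp
    with i(4) have b: "v i = w j" by simp
    have ui: "u i \<in> ?A" using i(1) by blast
    with i(4) have "u i \<noteq> v i" by metis
    then have "u i \<notin> insert (w j) (?A - {u j})"
      unfolding VW[symmetric] by simp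
    with ui have "u i = u j" by simp
    then have "i = j" using inj_onD[OF inj_u _ i(1) j(1)] by simp
    then have "u(i := v i) = u(j := w j)" using b by simp
    then show "v = w" by (simp only: i(2)[symmetric] j(2)[symmetric])
  qed
  show "(\<lambda>v. v ` {1..N}) ` {v \<in> distinct_torus L N. torus_adj L N u v}
      \<subseteq> {B \<in> configs L N. config_adj L ?A B}"
  proof (clarify, intro conjI)
    fix v assume v: "v \<in> distinct_torus L N" and adj: "torus_adj L N u v"
    show "v ` {1..N} \<in> configs L N" by (rule image_in_configs[OF v])
    obtain i where i: "i \<in> {1..N}" "nn L (u i) (v i)" "v = u(i := v i)" "v i \<in> sites L" "v i \<notin> ?A"
      using distinct_torus_adjE[OF L u v adj] by blast
    have "v ` {1..N} = insert (v i) (?A - {u i})"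
      by (rule distinct_torus_move(2)[OF u i(1,4,5), folded i(3)])
    with i show "config_adj L ?A (v ` {1..N})"
      unfolding config_adj_def by blast
  qed
  show "{B \<in> configs L N. config_adj L ?A B}
      \<subseteq> (\<lambda>v. v ` {1..N}) ` {v \<in> distinct_torus L N. torus_adj L N u v}"
  proof
    fix B assume "B \<in> {B \<in> configs L N. config_adj L ?A B}"
    then obtain i b where i: "i \<in> {1..N}" and b: "b \<in> sites L" "b \<notin> ?A"
      and nn: "nn L (u i) b" and B: "B = insert b (?A - {u i})"
      unfolding config_adj_def by blast
    have "torus_adj L N u (u(i := b))"
      unfolding torus_adj_def using nn i by (intro bexI[of _ i]) auto
    with distinct_torus_move[OF u i b] B
    show "B \<in> (\<lambda>v. v ` {1..N}) ` {v \<in> distinct_torus L N. torus_adj L N u v}"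
      by (intro image_eqI[of _ _ "u(i := b)"]) simp_all
  qed
qed

section \<open>The configuration graph\<close>

lemma finite_configs: "finite (configs L N)"
  by (rule finite_subset[of _ "Pow (sites L)"]) (auto simp: configs_def sites_eq)

text \<open>The eigenvector equation without the enumeration of the configurations.\<close>

lemma positive_eigenvector_sum:
  assumes \<psi>: "positive_eigenvector L N \<psi>" and A: "A \<in> configs L N"
  shows "(\<Sum>B\<in>{B \<in> configs L N. config_adj L A B}. \<psi> B) = config_radius L N * \<psi> A"
proof -
  let ?c = "card (configs L N)" and ?e = "from_nat_into (configs L N)"
  have bij: "bij_betw ?e {..<?c} (configs L N)"
    by (rule bij_betw_from_nat_into_finite[OF finite_configs])
  then have "A \<in> ?e ` {..<?c}"
    using A bij_betw_imp_surj_on by blast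
  then obtain i where i: "i < ?c" and ei: "?e i = A" by blast
  have "adj_matrix L N *\<^sub>v config_vec L N \<psi> = config_radius L N \<cdot>\<^sub>v config_vec L N \<psi>"
    using \<psi> by (simp add: positive_eigenvector_def eigenvector_def)
  then have "Matrix.vec_index (adj_matrix L N *\<^sub>v config_vec L N \<psi>) i =
      Matrix.vec_index (config_radius L N \<cdot>\<^sub>v config_vec L N \<psi>) i"
    by simp
  then have "(\<Sum>j<?c. (if config_adj L A (?e j) then 1 else 0) * \<psi> (?e j)) = config_radius L N * \<psi> A"
    using i ei by (simp add: adj_matrix_def config_vec_def scalar_prod_def atLeast0LessThan)
  also have "(\<Sum>j<?c. (if config_adj L A (?e j) then 1 else 0) * \<psi> (?e j)) =
      (\<Sum>B\<in>configs L N. (if config_adj L A B then 1 else 0) * \<psi> B)"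
    by (rule sum.reindex_bij_betw[OF bij])
  also have "\<dots> = (\<Sum>B\<in>{B \<in> configs L N. config_adj L A B}. \<psi> B)"
    unfolding sum.inter_filter[OF finite_configs] by (intro sum.cong) auto
  finally show ?thesis .
qed

text \<open>Some particle has an empty site directly above it: otherwise the occupied set would be closed
  under adding one and hence be the whole circle, but \<open>N < L\<close>.\<close>

lemma config_has_neighbour:
  assumes "1 \<le> N" and "N \<le> L - 1" and A: "A \<in> configs L N"
  shows "\<exists>B\<in>configs L N. config_adj L A B"
proof -
  have A_sub: "A \<subseteq> sites L" and cA: "card A = N" using A by (auto simp: configs_def)
  have fin: "finite A" using A_sub by (rule finite_subset) (simp add: sites_eq)
  obtain a\<^sub>0 where a0: "a\<^sub>0 \<in> A" using cA \<open>1 \<le> N\<close> by fastforce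
  have L0: "0 < int L" using assms by simp
  have "\<exists>a\<in>A. (a + 1) mod int L \<notin> A"
  proof (rule ccontr)
    assume "\<not> (\<exists>a\<in>A. (a + 1) mod int L \<notin> A)"
    then have closed: "(a + 1) mod int L \<in> A" if "a \<in> A" for a using that by blast
    have orbit: "(a\<^sub>0 + int k) mod int L \<in> A" for k
    proof (induction k)
      case 0
      then show ?case using a0 A_sub by (auto simp: sites_eq)
    next
      case (Suc k)
      then have "((a\<^sub>0 + int k) mod int L + 1) mod int L \<in> A" by (rule closed)
      moreover have "((a\<^sub>0 + int k) mod int L + 1) mod int L = (a\<^sub>0 + int (Suc k)) mod int L"
        unfolding mod_add_left_eq by (simp add: ac_simps)
      ultimately show ?case by simp
    qed
    have "b \<in> A" if b: "b \<in> sites L" for b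
    proof -
      have "(a\<^sub>0 + int (nat ((b - a\<^sub>0) mod int L))) mod int L = b"
        using b L0 by (simp add: sites_eq mod_add_right_eq)
      with orbit show ?thesis by metis
    qed
    then have "A = sites L" using A_sub by blast
    then have "N = L" using cA by (simp add: sites_eq)
    with assms show False by simp
  qed
  then obtain a where a: "a \<in> A" "(a + 1) mod int L \<notin> A" by blast
  let ?b = "(a + 1) mod int L"
  have b: "?b \<in> sites L" using L0 by (simp add: sites_eq)
  have "config_adj L A (insert ?b (A - {a}))"
    unfolding config_adj_def using a b by (intro bexI[of _ a] bexI[of _ ?b]) (auto simp: nn_def cong_def)
  moreover have "insert ?b (A - {a}) \<in> configs L N"
    using A_sub b a fin cA \<open>1 \<le> N\<close> by (auto simp: configs_def)
  ultimately show ?thesis by blast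
qed

text \<open>The eigenvalue is read off from the eigenvector equation at one configuration, where a sum of
  positive terms over a nonempty set of neighbours appears.\<close>

lemma config_radius_pos:
  assumes "1 \<le> N" "N \<le> L - 1" "positive_eigenvector L N \<psi>" and A: "A \<in> configs L N"
  shows "0 < config_radius L N"
proof -
  have pos: "0 < \<psi> B" if "B \<in> configs L N" for B
    using assms(3) that by (simp add: positive_eigenvector_def)
  obtain B where B: "B \<in> configs L N" "config_adj L A B"
    using config_has_neighbour[OF assms(1,2) A] by blast
  then have "0 < (\<Sum>B\<in>{B \<in> configs L N. config_adj L A B}. \<psi> B)"
    using pos finite_configs by (intro sum_pos) auto
  then show ?thesis
    using positive_eigenvector_sum[OF assms(3) A] pos[OF A] by (simp add: zero_less_mult_iff)
qed

section \<open>Cyclically ordered points\<close>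

lemma W_subset_distinct_torus: "W L N \<subseteq> distinct_torus L N"
proof
  fix \<theta> assume "\<theta> \<in> W L N"
  then obtain x :: "nat \<Rightarrow> int" where t: "\<theta> \<in> torus L N" and x: "strict_mono_on {1..N} x"
    "x N < x 1 + int L" "\<And>k. k \<in> {1..N} \<Longrightarrow> \<theta> k = x k mod int L"
    unfolding W_def by blast
  have "\<theta> k \<noteq> \<theta> l" if kl: "k \<in> {1..N}" "l \<in> {1..N}" "k < l" for k l
  proof
    assume "\<theta> k = \<theta> l"
    then have "\<theta> l = \<theta> k" ..
    then have "int L dvd x l - x k"
      using x(3)[OF kl(1)] x(3)[OF kl(2)] by (simp add: mod_eq_dvd_iff)
    moreover have lt: "0 < x l - x k"
      using strict_mono_onD[OF x(1) kl] by simp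
    ultimately have "int L \<le> x l - x k" by (rule zdvd_imp_le)
    moreover have "x 1 \<le> x k" "x l \<le> x N"
      using kl by (auto intro!: strict_mono_on_leD[OF x(1)])
    ultimately show False using x(2) by simp
  qed
  then have "inj_on \<theta> {1..N}" by (intro linorder_inj_onI) auto
  with t show "\<theta> \<in> distinct_torus L N" by (simp add: distinct_torus_def)
qed

text \<open>Lift the move to the integers.  Strict inequalities between integers leave room for one unit,
  so a single move can at worst turn one of them into an equality, and the equality would be a
  collision.  With a single particle the closing inequality \<open>x N < x 1 + L\<close> compares the particle with
  its own translate and is preserved for a different reason.\<close>

lemma W_closed_under_moves:
  assumes N: "1 \<le> N" and u: "u \<in> W L N" and v: "v \<in> distinct_torus L N"
    and adj: "torus_adj L N u v"
  shows "v \<in> W L N"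
proof -
  obtain x :: "nat \<Rightarrow> int" where x: "strict_mono_on {1..N} x" "x N < x 1 + int L"
    and ux: "\<And>k. k \<in> {1..N} \<Longrightarrow> u k = x k mod int L"
    using u unfolding W_def by blast
  have vt: "v \<in> torus L N" and inj: "inj_on v {1..N}"
    using v by (simp_all add: distinct_torus_def)
  obtain i where i: "i \<in> {1..N}" "nn L (u i) (v i)" and eq: "\<And>j. j \<in> {1..N} \<Longrightarrow> j \<noteq> i \<Longrightarrow> u j = v j"
    using adj unfolding torus_adj_def by blast
  have vi: "v i = v i mod int L"
    using vt i(1) by (auto simp: torus_def sites_eq PiE_iff)
  obtain d where d: "d = 1 \<or> d = - 1" and vd: "[v i = u i + d] (mod int L)"
    using i(2) unfolding nn_def by (metis diff_conv_add_uminus)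
  define x' where "x' = x(i := x i + d)"
  have vx: "v k = x' k mod int L" if "k \<in> {1..N}" for k
  proof (cases "k = i")
    case True
    have "v i = (x i mod int L + d) mod int L"
      using vi vd ux[OF i(1)] by (simp add: cong_def)
    with True show ?thesis by (simp add: x'_def mod_add_left_eq)
  next
    case False
    with that show ?thesis using eq ux by (simp add: x'_def)
  qed
  have "strict_mono_on {1..N} x'"
  proof (rule strict_mono_onI)
    fix k l assume kl: "k \<in> {1..N}" "l \<in> {1..N}" "k < l"
    have "x k < x l" using strict_mono_onD[OF x(1) kl] .
    then have "x' k \<le> x' l" using d kl(3) by (auto simp: x'_def)
    moreover have "x' k \<noteq> x' l"
      using vx[OF kl(1)] vx[OF kl(2)] inj_onD[OF inj _ kl(1,2)] kl(3) by auto
    ultimately show "x' k < x' l" by simp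
  qed
  moreover have "x' N < x' 1 + int L"
  proof (cases "N = 1")
    case True
    then show ?thesis using x(2) by simp
  next
    case False
    have "x' N \<le> x' 1 + int L" using x(2) d False by (auto simp: x'_def)
    moreover have "x' N \<noteq> x' 1 + int L"
      using vx[of N] vx[of 1] inj_onD[OF inj, of N 1] False N by auto
    ultimately show ?thesis by simp
  qed
  ultimately show ?thesis unfolding W_def using vt vx by blast
qed

section \<open>Relabelling the coordinates\<close>

lemma torus_permute:
  assumes "\<tau> permutes {1..N}" and "u \<in> torus L N"
  shows "u \<circ> \<tau> \<in> torus L N"
  using assms permutes_in_image[OF assms(1)] permutes_not_in[OF assms(1)]
  by (auto simp: torus_def PiE_iff extensional_def)

lemma distinct_torus_permute:
  assumes "\<tau> permutes {1..N}" and "u \<in> distinct_torus L N"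
  shows "u \<circ> \<tau> \<in> distinct_torus L N"
  using assms torus_permute[OF assms(1)] permutes_image[OF assms(1)] permutes_inj_on[OF assms(1)]
  by (auto simp: distinct_torus_def intro!: comp_inj_on)

lemma torus_adj_permuteI:
  assumes \<tau>: "\<tau> permutes {1..N}" and adj: "torus_adj L N u v"
  shows "torus_adj L N (u \<circ> \<tau>) (v \<circ> \<tau>)"
proof -
  obtain i where i: "i \<in> {1..N}" "nn L (u i) (v i)" and eq: "\<And>j. j \<in> {1..N} \<Longrightarrow> j \<noteq> i \<Longrightarrow> u j = v j"
    using adj unfolding torus_adj_def by blast
  have t: "\<tau> (inv_into UNIV \<tau> i) = i" by (rule permutes_inverses(1)[OF \<tau>])
  have "inv_into UNIV \<tau> i \<in> {1..N}" using permutes_in_image[OF permutes_inv[OF \<tau>]] i(1) by blast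
  moreover have "(u \<circ> \<tau>) j = (v \<circ> \<tau>) j" if j: "j \<in> {1..N} - {inv_into UNIV \<tau> i}" for j
  proof -
    have "\<tau> j \<noteq> i" using j permutes_inverses(2)[OF \<tau>, of j] by auto
    moreover have "\<tau> j \<in> {1..N}" using permutes_in_image[OF \<tau>] j by blast
    ultimately show ?thesis using eq by simp
  qed
  ultimately show ?thesis
    unfolding torus_adj_def using i(2) t by (intro bexI[of _ "inv_into UNIV \<tau> i"]) simp_all
qed

text \<open>Adjacency is unchanged when the particles are relabelled simultaneously in both points, and the
  set of occupied sites does not see the labels.\<close>

lemma messep_kernel_permute:
  assumes \<tau>: "\<tau> permutes {1..N}"
  shows "messep_kernel L N \<psi> (u \<circ> \<tau>) (v \<circ> \<tau>) = messep_kernel L N \<psi> u v"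
proof -
  have "torus_adj L N u v" if "torus_adj L N (u \<circ> \<tau>) (v \<circ> \<tau>)"
    using torus_adj_permuteI[OF permutes_inv[OF \<tau>] that]
    by (simp add: comp_assoc permutes_inv_o[OF \<tau>])
  then have "torus_adj L N (u \<circ> \<tau>) (v \<circ> \<tau>) \<longleftrightarrow> torus_adj L N u v"
    using torus_adj_permuteI[OF \<tau>] by blast
  moreover have "(u \<circ> \<tau>) ` {1..N} = u ` {1..N}" for u :: "nat \<Rightarrow> int"
    by (simp only: image_comp[symmetric] permutes_image[OF \<tau>])
  ultimately show ?thesis by (simp add: messep_kernel_def)
qed

section \<open>Conditioning the walk on not colliding\<close>

lemma less_collision_time_iff:
  "enat m < collision_time N Y \<omega> \<longleftrightarrow> (\<forall>k\<le>m. inj_on (Y k \<omega>) {1..N})"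
proof -
  have "enat m < collision_time N Y \<omega> \<longleftrightarrow>
      (\<forall>n. (\<exists>i\<in>{1..N}. \<exists>j\<in>{1..N}. i \<noteq> j \<and> Y n \<omega> i = Y n \<omega> j) \<longrightarrow> m < n)"
    unfolding collision_time_def Suc_ile_eq[symmetric] by (auto simp: le_Inf_iff Suc_le_eq)
  also have "\<dots> \<longleftrightarrow> (\<forall>n. \<not> inj_on (Y n \<omega>) {1..N} \<longrightarrow> m < n)"
    unfolding inj_on_def by metis
  also have "\<dots> \<longleftrightarrow> (\<forall>k\<le>m. inj_on (Y k \<omega>) {1..N})"
    by (metis not_less)
  finally show ?thesis .
qed

text \<open>The degree of the torus is expressed through the point \<open>y\<close> only to have a name for the common
  value.  It cancels in the Doob transform, which is why the MESSEP kernel involves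
  \<open>config_radius\<close> alone.\<close>

lemma srw_symmetric_killed_kernel:
  assumes N: "1 \<le> N" "N \<le> L - 1" and \<psi>: "positive_eigenvector L N \<psi>" and y: "y \<in> distinct_torus L N"
  defines "\<mu> \<equiv> config_radius L N / real (card {w \<in> torus L N. torus_adj L N y w})"
  defines "h \<equiv> \<lambda>u. \<psi> (u ` {1..N})"
  shows "symmetric_killed_kernel (distinct_torus L N) (srw_kernel L N) h \<mu>"
    and "\<And>u v. u \<in> distinct_torus L N \<Longrightarrow>
      srw_kernel L N u v * h v / (\<mu> * h u) = messep_kernel L N \<psi> u v"
proof -
  let ?D = "distinct_torus L N"
  define d where "d = real (card {w \<in> torus L N. torus_adj L N y w})"
  have L: "2 \<le> L" using N by simp
  have D_torus: "u \<in> torus L N" if "u \<in> ?D" for u using that by (simp add: distinct_torus_def)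
  have srw: "srw_kernel L N u v = (if torus_adj L N u v then 1 / d else 0)" if "u \<in> ?D" for u v
    using torus_degree_const[OF L D_torus[OF that] D_torus[OF y]] by (simp add: srw_kernel_def d_def)
  obtain B where "B \<in> configs L N" "config_adj L (y ` {1..N}) B"
    using config_has_neighbour[OF N image_in_configs[OF y]] by blast
  then obtain w where "w \<in> ?D" "torus_adj L N y w"
    using bij_betw_imp_surj_on[OF bij_betw_neighbours[OF L y]] by blast
  then have "w \<in> {w \<in> torus L N. torus_adj L N y w}" using D_torus by simp
  then have d: "0 < d"
    unfolding d_def using finite_torus by (simp add: card_gt_0_iff) blast
  have \<rho>: "0 < config_radius L N"
    by (rule config_radius_pos[OF N \<psi> image_in_configs[OF y]])
  have \<mu>: "\<mu> = config_radius L N / d" by (simp add: \<mu>_def d_def)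
  show "symmetric_killed_kernel ?D (srw_kernel L N) h \<mu>"
  proof
    show "finite ?D" by (rule finite_distinct_torus)
    show "0 < \<mu>" using d \<rho> by (simp add: \<mu>)
    fix u assume u: "u \<in> ?D"
    show "0 < h u"
      using \<psi> image_in_configs[OF u] by (simp add: h_def positive_eigenvector_def)
    have "(\<Sum>v\<in>?D. srw_kernel L N u v * h v) = (\<Sum>v\<in>?D. if torus_adj L N u v then h v / d else 0)"
      by (intro sum.cong) (auto simp: srw[OF u])
    also have "\<dots> = (\<Sum>v\<in>{v \<in> ?D. torus_adj L N u v}. \<psi> (v ` {1..N})) / d"
      by (simp add: sum.inter_filter[OF finite_distinct_torus, symmetric] sum_divide_distrib h_def)
    also have "(\<Sum>v\<in>{v \<in> ?D. torus_adj L N u v}. \<psi> (v ` {1..N})) = config_radius L N * h u"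
      unfolding sum.reindex_bij_betw[OF bij_betw_neighbours[OF L u]]
        positive_eigenvector_sum[OF \<psi> image_in_configs[OF u]] h_def ..
    finally show "(\<Sum>v\<in>?D. srw_kernel L N u v * h v) = \<mu> * h u" by (simp add: \<mu>)
    fix v assume v: "v \<in> ?D"
    show "0 \<le> srw_kernel L N u v" using d by (simp add: srw[OF u])
    show "srw_kernel L N u v = srw_kernel L N v u"
      using torus_adj_sym by (auto simp: srw[OF u] srw[OF v])
  qed
  show "srw_kernel L N u v * h v / (\<mu> * h u) = messep_kernel L N \<psi> u v" if "u \<in> ?D" for u v
    using d by (simp add: srw[OF that] messep_kernel_def \<mu> h_def)
qed

theorem proposition2p1:
  fixes L N :: nat
    and \<psi> :: "int set \<Rightarrow> real"
    and M :: "'a measure" and Y :: "nat \<Rightarrow> 'a \<Rightarrow> nat \<Rightarrow> int"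
    and M' :: "'b measure" and \<Theta> :: "nat \<Rightarrow> 'b \<Rightarrow> nat \<Rightarrow> int"
    and y :: "nat \<Rightarrow> int" and \<sigma> :: "nat \<Rightarrow> nat"
  assumes "1 \<le> N" and "N \<le> L - 1"
    and "positive_eigenvector L N \<psi>"
    and "y \<in> torus L N" and "inj_on y {1..N}"
    and "markov_chain_from M (torus L N) (srw_kernel L N) y Y"
    and "\<sigma> permutes {1..N}" and "y \<circ> \<sigma> \<in> W L N"
    and "markov_chain_from M' (W L N) (messep_kernel L N \<psi>) (y \<circ> \<sigma>) \<Theta>"
  shows "\<forall>n e. (\<forall>k\<le>n. e k \<in> torus L N) \<longrightarrow>
    (\<lambda>m. \<P>(\<omega> in M. (\<forall>k\<le>n. Y k \<omega> \<circ> \<sigma> = e k) \<bar> enat m < collision_time N Y \<omega>))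
      \<longlonglongrightarrow> \<P>(\<omega> in M'. \<forall>k\<le>n. \<Theta> k \<omega> = e k)"
proof (intro allI impI)
  fix n and e :: "nat \<Rightarrow> nat \<Rightarrow> int"
  assume e: "\<forall>k\<le>n. e k \<in> torus L N"
  note N = assms(1,2) and \<psi> = assms(3) and mc = assms(6) and \<sigma> = assms(7) and mc' = assms(9)
  let ?D = "distinct_torus L N" and ?K = "messep_kernel L N \<psi>"
  define s where "s k = e k \<circ> inv_into UNIV \<sigma>" for k
  have es: "e k = s k \<circ> \<sigma>" for k
    by (simp add: s_def comp_assoc permutes_inv_o[OF \<sigma>])
  have eq_iff: "u \<circ> \<sigma> = e k \<longleftrightarrow> u = s k" for u k
    by (metis comp_assoc comp_id es permutes_inv_o(1)[OF \<sigma>])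
  have y: "y \<in> ?D" using assms(4,5) by (simp add: distinct_torus_def)
  interpret M: prob_space M using mc by (simp add: markov_chain_from_def)
  interpret M': prob_space M' using mc' by (simp add: markov_chain_from_def)
  interpret symmetric_killed_kernel ?D "srw_kernel L N" "\<lambda>u. \<psi> (u ` {1..N})"
    "config_radius L N / real (card {w \<in> torus L N. torus_adj L N y w})"
    by (rule srw_symmetric_killed_kernel(1)[OF N \<psi> y])
  have Y_torus: "Y k \<omega> \<in> torus L N" if "\<omega> \<in> space M" for k \<omega>
    using mc measurable_space[of "Y k" M "count_space (torus L N)"] that
    by (simp add: markov_chain_from_def)
  have \<Theta>_W: "\<Theta> k \<omega> \<in> W L N" if "\<omega> \<in> space M'" for k \<omega>
    using mc' measurable_space[of "\<Theta> k" M' "count_space (W L N)"] that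
    by (simp add: markov_chain_from_def)
  have survive: "enat m < collision_time N Y \<omega> \<longleftrightarrow> (\<forall>k\<le>m. Y k \<omega> \<in> ?D)"
    if "\<omega> \<in> space M" for m \<omega>
    using Y_torus[OF that] by (simp add: less_collision_time_iff distinct_torus_def)
  have lhs: "\<P>(\<omega> in M. (\<forall>k\<le>n. Y k \<omega> \<circ> \<sigma> = e k) \<bar> enat m < collision_time N Y \<omega>) =
      \<P>(\<omega> in M. (\<forall>k\<le>n. Y k \<omega> = s k) \<bar> (\<forall>k\<le>m. Y k \<omega> \<in> ?D))" for m
    unfolding cond_prob_def eq_iff using survive by (simp cong: conj_cong)
  have rhs_0: "\<P>(\<omega> in M'. \<forall>k\<le>n. \<Theta> k \<omega> = e k) = 0" if "\<not> (\<forall>k\<le>n. e k \<in> W L N)"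
  proof -
    from that obtain k where "k \<le> n" "e k \<notin> W L N" by blast
    then have "\<not> (\<forall>k\<le>n. \<Theta> k \<omega> = e k)" if "\<omega> \<in> space M'" for \<omega>
      using \<Theta>_W[OF that, of k] by metis
    then have "{\<omega> \<in> space M'. \<forall>k\<le>n. \<Theta> k \<omega> = e k} = {}" by blast
    then show ?thesis by (simp only: measure_empty)
  qed
  show "(\<lambda>m. \<P>(\<omega> in M. (\<forall>k\<le>n. Y k \<omega> \<circ> \<sigma> = e k) \<bar> enat m < collision_time N Y \<omega>))
      \<longlonglongrightarrow> \<P>(\<omega> in M'. \<forall>k\<le>n. \<Theta> k \<omega> = e k)"
  proof (cases "\<forall>k\<le>n. s k \<in> ?D")
    case True
    have e0: "s 0 = y \<longleftrightarrow> e 0 = y \<circ> \<sigma>" using eq_iff[of y 0] by metis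
    have e_D: "e k \<in> ?D" if "k \<le> n" for k
      unfolding es using True that by (intro distinct_torus_permute[OF \<sigma>]) simp
    have prod_eq: "(\<Prod>k<n. srw_kernel L N (s k) (s (Suc k)) * \<psi> (s (Suc k) ` {1..N}) /
        (config_radius L N / real (card {w \<in> torus L N. torus_adj L N y w}) * \<psi> (s k ` {1..N}))) =
        (\<Prod>k<n. ?K (e k) (e (Suc k)))"
      unfolding es messep_kernel_permute[OF \<sigma>]
      using True by (intro prod.cong refl srw_symmetric_killed_kernel(2)[OF N \<psi> y]) simp
    have D_sub: "?D \<subseteq> torus L N" by (auto simp: distinct_torus_def)
    have lim: "(\<lambda>m. \<P>(\<omega> in M. (\<forall>k\<le>n. Y k \<omega> \<circ> \<sigma> = e k) \<bar> enat m < collision_time N Y \<omega>))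
        \<longlonglongrightarrow> (if e 0 = y \<circ> \<sigma> then \<Prod>k<n. ?K (e k) (e (Suc k)) else 0)"
      using conditioned_path_tendsto[OF mc D_sub y True] by (simp only: lhs e0 prod_eq)
    have "(if e 0 = y \<circ> \<sigma> then \<Prod>k<n. ?K (e k) (e (Suc k)) else 0) =
        \<P>(\<omega> in M'. \<forall>k\<le>n. \<Theta> k \<omega> = e k)"
    proof (cases "\<forall>k\<le>n. e k \<in> W L N")
      case True
      then show ?thesis by (rule markov_chain_path_probability[OF mc', symmetric])
    next
      case notW: False
      have "(\<Prod>k<n. ?K (e k) (e (Suc k))) = 0" if start: "e 0 = y \<circ> \<sigma>"
      proof (rule ccontr)
        \<comment> \<open>A nonzero product is a walk of collision-free moves from a point of \<open>W L N\<close>, which cannot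
          leave \<open>W L N\<close>.\<close>
        assume "(\<Prod>k<n. ?K (e k) (e (Suc k))) \<noteq> 0"
        then have "?K (e k) (e (Suc k)) \<noteq> 0" if "k < n" for k
          using that by simp
        then have adj: "torus_adj L N (e k) (e (Suc k))" if "k < n" for k
          using that unfolding messep_kernel_def by meson
        have "e k \<in> W L N" if "k \<le> n" for k
          using that
        proof (induction k)
          case 0
          show ?case unfolding start by (rule assms(8))
        next
          case (Suc k)
          then show ?case
            by (intro W_closed_under_moves[OF assms(1) _ e_D adj]) simp_all
        qed
        with notW show False by blast
      qed
      with rhs_0[OF notW] show ?thesis by simp
    qed
    with lim show ?thesis by simp
  next
    case False
    then obtain k where k: "k \<le> n" "s k \<notin> ?D" by blast
    have "\<P>(\<omega> in M. (\<forall>k\<le>n. Y k \<omega> \<circ> \<sigma> = e k) \<bar> enat m < collision_time N Y \<omega>) = 0" if "n \<le> m" for m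
    proof -
      have "\<not> ((\<forall>k\<le>n. Y k \<omega> = s k) \<and> (\<forall>k\<le>m. Y k \<omega> \<in> ?D))" for \<omega>
      proof
        assume *: "(\<forall>k\<le>n. Y k \<omega> = s k) \<and> (\<forall>k\<le>m. Y k \<omega> \<in> ?D)"
        then have "Y k \<omega> = s k" using k(1) by blast
        moreover have "Y k \<omega> \<in> ?D" using * order_trans[OF k(1) that] by blast
        ultimately show False using k(2) by metis
      qed
      then have "{\<omega> \<in> space M. (\<forall>k\<le>n. Y k \<omega> = s k) \<and> (\<forall>k\<le>m. Y k \<omega> \<in> ?D)} = {}"
        by blast
      then show ?thesis unfolding lhs unfolding cond_prob_def by (simp only: measure_empty div_0)
    qed
    then have "(\<lambda>m. \<P>(\<omega> in M. (\<forall>k\<le>n. Y k \<omega> \<circ> \<sigma> = e k) \<bar> enat m < collision_time N Y \<omega>)) \<longlonglongrightarrow> 0"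
      by (intro tendsto_eventually eventually_sequentiallyI)
    moreover have "e k \<notin> W L N"
    proof
      assume "e k \<in> W L N"
      then have "s k \<in> ?D"
        unfolding s_def using W_subset_distinct_torus
        by (intro distinct_torus_permute[OF permutes_inv[OF \<sigma>]]) blast
      with k show False by simp
    qed
    with k(1) rhs_0 have "\<P>(\<omega> in M'. \<forall>k\<le>n. \<Theta> k \<omega> = e k) = 0" by blast
    ultimately show ?thesis by simp
  qed
qed

end
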